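(* Let $l$ and $s$ be non-negative integers with $0\le s\le l$. Then $$F_{2,l}^{(2l-s,s)}(\alpha)=(1+\alpha)^{l-s}\,G_s^l(\alpha),$$ where $G_n^\gamma(x)=F(-n,\gamma-n+1,-\gamma;-x)$, and $F_{2,l}^{(2l-s,s)}(\alpha)$ is the (scalar) transition matrix defined in the context.
   Context: $F(-n,b,c;x)=1+\sum_{k=1}^n\frac{(-n)_k(b)_k}{(c)_k}\frac{x^k}{k!}$ is the Gaussian hypergeometric polynomial, $(a)_k=a(a+1)\cdots(a+k-1)$. Let $X=(x_{ij})_{1\le i,j\le 2}$ be a matrix of variables. For $k_1,k_2\in\{1,2\}$ put $D^{(\alpha)}(k_1,k_2)=x_{k_11}x_{k_22}+\alpha\,x_{k_21}x_{k_12}$ (the $\alpha$-determinant of the matrix with rows $k_1,k_2$ of $X$). Let $\mathbb{M}_{2,l}$ be the set of $2\times2$ matrices $M=(m_{ij})$ with nonnegative integer entries and both column sums equal to $l$. For $N\in\mathbb{M}_{2,1}$, $N=(\delta_{i,k_j})_{i,j}$, put $D^{(\alpha)}(N)=D^{(\alpha)}(k_1,k_2)$, and for $M\in\mathbb{M}_{2,l}$ put $$D^{(\alpha)}(M)=\frac{\prod_{i,j}m_{ij}!}{(l!)^2}\sum_{(M_1,\dots,M_l)}D^{(\alpha)}(M_1)\cdots D^{(\alpha)}(M_l),$$ the sum over all $(M_1,\dots,M_l)\in(\mathbb{M}_{2,1})^l$ with $\sum_i M_i=M$. Let $\boldsymbol e_1,\boldsymbol e_2$ be the standard basis of $\mathbb{C}^2$.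 The linear map $\Phi^{(\alpha)}:(\mathrm{Sym}^l(\mathbb{C}^2))^{\otimes2}\to\mathbb{C}[x_{11},x_{12},x_{21},x_{22}]$ is defined by $\Phi^{(\alpha)}(\boldsymbol e_1^{m_{11}}\boldsymbol e_2^{m_{21}}\otimes\boldsymbol e_1^{m_{12}}\boldsymbol e_2^{m_{22}})=D^{(\alpha)}(M)$. It is a $\mathcal{U}(\mathfrak{gl}_2)$-intertwiner for the natural action on the source and the action $E_{ij}\cdot f=\sum_{k}x_{ik}\,\partial f/\partial x_{jk}$ on polynomials. The space of highest weight vectors of weight $(2l-s,s)$ in $(\mathrm{Sym}^l(\mathbb{C}^2))^{\otimes2}$ is one-dimensional; let $v^{(2l-s,s)}$ be a nonzero element. Then $F_{2,l}^{(2l-s,s)}(\alpha)$ is the unique scalar with $\Phi^{(\alpha)}(v^{(2l-s,s)})=F_{2,l}^{(2l-s,s)}(\alpha)\,\Phi^{(0)}(v^{(2l-s,s)})$. *)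

theory Defs
  imports "HOL-Analysis.Analysis" "HOL-Library.Poly_Mapping"
begin

text \<open>
  Rows, columns and basis vectors are indexed by the type \<open>2\<close>, whose two elements are \<open>1\<close> and
  \<open>2\<close>. A vector space with a distinguished basis indexed by \<open>'a\<close> is modelled by
  \<open>'a \<Rightarrow>\<^sub>0 complex\<close>; in particular the polynomials in variables \<open>'v\<close> are spanned by the monomials
  \<open>'v \<Rightarrow>\<^sub>0 nat\<close>, and the library's convolution product is the product of polynomials.
\<close>

type_synonym 'v poly_ring = "('v \<Rightarrow>\<^sub>0 nat) \<Rightarrow>\<^sub>0 complex"

definition cscale :: "complex \<Rightarrow> ('a \<Rightarrow>\<^sub>0 complex) \<Rightarrow> ('a \<Rightarrow>\<^sub>0 complex)" where
  "cscale c f = Poly_Mapping.map ((*) c) f"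

definition lin_ext :: "('a \<Rightarrow> ('b \<Rightarrow>\<^sub>0 complex)) \<Rightarrow> ('a \<Rightarrow>\<^sub>0 complex) \<Rightarrow> ('b \<Rightarrow>\<^sub>0 complex)" where
  "lin_ext \<phi> f = (\<Sum>a\<in>Poly_Mapping.keys f. cscale (Poly_Mapping.lookup f a) (\<phi> a))"

definition pvar :: "'v \<Rightarrow> 'v poly_ring" where
  "pvar v = Poly_Mapping.single (Poly_Mapping.single v 1) 1"

definition partial_deriv :: "'v \<Rightarrow> 'v poly_ring \<Rightarrow> 'v poly_ring" where
  "partial_deriv v = lin_ext (\<lambda>m. Poly_Mapping.single (m - Poly_Mapping.single v 1)
                                    (of_nat (Poly_Mapping.lookup m v)))"


subsection \<open>The representation on the tensor square of \<open>Sym\<^sup>l(\<complex>\<^sup>2)\<close>\<close>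

text \<open>
  The symmetric algebra of \<open>\<complex>\<^sup>2\<close> is the polynomial ring in the basis vectors \<open>e\<^sub>1, e\<^sub>2\<close>.
  The matrix unit \<open>E\<^sub>i\<^sub>j\<close> acts on it as the derivation extending \<open>e\<^sub>k \<mapsto> \<delta>\<^sub>j\<^sub>k e\<^sub>i\<close>. The tensor square
  has the basis \<open>e\<^sup>a \<otimes> e\<^sup>b\<close>, labelled by the pairs of exponents \<open>(a, b)\<close>.
\<close>

type_synonym sym_alg = "2 poly_ring"
type_synonym sym_tensor = "(2 \<Rightarrow>\<^sub>0 nat) \<times> (2 \<Rightarrow>\<^sub>0 nat) \<Rightarrow>\<^sub>0 complex"

definition sym_act :: "2 \<Rightarrow> 2 \<Rightarrow> sym_alg \<Rightarrow> sym_alg" where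
  "sym_act i j f = pvar i * partial_deriv j f"

definition tensor :: "sym_alg \<Rightarrow> sym_alg \<Rightarrow> sym_tensor" where
  "tensor f g = lin_ext (\<lambda>a. lin_ext (\<lambda>b. Poly_Mapping.single (a, b) 1) g) f"

definition tensor_act :: "2 \<Rightarrow> 2 \<Rightarrow> sym_tensor \<Rightarrow> sym_tensor" where
  "tensor_act i j = lin_ext (\<lambda>(a, b).
      tensor (sym_act i j (Poly_Mapping.single a 1)) (Poly_Mapping.single b 1)
    + tensor (Poly_Mapping.single a 1) (sym_act i j (Poly_Mapping.single b 1)))"

definition sym_power_tensor :: "nat \<Rightarrow> sym_tensor set" where
  "sym_power_tensor l = {w. \<forall>(a, b)\<in>Poly_Mapping.keys w.
      (\<Sum>i\<in>UNIV. Poly_Mapping.lookup a i) = l \<and> (\<Sum>i\<in>UNIV. Poly_Mapping.lookup b i) = l}"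

text \<open>The zero vector belongs to this space; \<open>E\<^sub>1\<^sub>2\<close> is the raising operator.\<close>

definition highest_weight_space :: "nat \<Rightarrow> nat \<times> nat \<Rightarrow> sym_tensor set" where
  "highest_weight_space l \<mu> = {w \<in> sym_power_tensor l.
      tensor_act 1 1 w = cscale (of_nat (fst \<mu>)) w \<and>
      tensor_act 2 2 w = cscale (of_nat (snd \<mu>)) w \<and>
      tensor_act 1 2 w = 0}"


subsection \<open>The \<open>\<alpha>\<close>-determinants \<open>D\<^sup>(\<^sup>\<alpha>\<^sup>)(M)\<close> and the map \<open>\<Phi>\<^sup>(\<^sup>\<alpha>\<^sup>)\<close>\<close>

type_synonym xpoly = "(2 \<times> 2) poly_ring"

definition alpha_det :: "complex \<Rightarrow> 2 \<Rightarrow> 2 \<Rightarrow> xpoly" where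
  "alpha_det \<alpha> k\<^sub>1 k\<^sub>2 = pvar (k\<^sub>1, 1) * pvar (k\<^sub>2, 2) + cscale \<alpha> (pvar (k\<^sub>2, 1) * pvar (k\<^sub>1, 2))"

definition column_sum_matrices :: "nat \<Rightarrow> (nat^2^2) set" where
  "column_sum_matrices l = {M. \<forall>j. (\<Sum>i\<in>UNIV. M $ i $ j) = l}"

definition alpha_det_unit :: "complex \<Rightarrow> nat^2^2 \<Rightarrow> xpoly" where
  "alpha_det_unit \<alpha> N =
     (let k = (THE k :: 2 \<Rightarrow> 2. N = (\<chi> i j. if i = k j then 1 else 0)) in alpha_det \<alpha> (k 1) (k 2))"

definition alpha_det_matrix :: "complex \<Rightarrow> nat \<Rightarrow> nat^2^2 \<Rightarrow> xpoly" where
  "alpha_det_matrix \<alpha> l M =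
     cscale ((\<Prod>i\<in>UNIV. \<Prod>j\<in>UNIV. fact (M $ i $ j)) / (fact l)\<^sup>2)
       (\<Sum>Ms | length Ms = l \<and> set Ms \<subseteq> column_sum_matrices 1 \<and> sum_list Ms = M.
          prod_list (map (alpha_det_unit \<alpha>) Ms))"

text \<open>
  The basis vector \<open>e\<^sup>a \<otimes> e\<^sup>b\<close> is sent to \<open>D\<^sup>(\<^sup>\<alpha>\<^sup>)(M)\<close> where \<open>M\<close> has columns \<open>a\<close> and \<open>b\<close>. Only the
  values on \<open>sym_power_tensor l\<close> are meaningful.
\<close>

definition Phi :: "complex \<Rightarrow> nat \<Rightarrow> sym_tensor \<Rightarrow> xpoly" where
  "Phi \<alpha> l = lin_ext (\<lambda>(a, b).
     alpha_det_matrix \<alpha> l (\<chi> i j. Poly_Mapping.lookup (if j = 1 then a else b) i))"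

text \<open>
  The highest weight space is a line when \<open>\<mu> = (2l - s, s)\<close> with \<open>s \<le> l\<close>, so quantifying over
  all its nonzero vectors agrees with choosing one.
\<close>

definition transition_scalar :: "nat \<Rightarrow> nat \<times> nat \<Rightarrow> complex \<Rightarrow> complex" where
  "transition_scalar l \<mu> \<alpha> =
     (THE c. \<forall>v\<in>highest_weight_space l \<mu>. v \<noteq> 0 \<longrightarrow> Phi \<alpha> l v = cscale c (Phi 0 l v))"


subsection \<open>Hypergeometric polynomials\<close>

text \<open>\<open>hypergeom_poly n b c x\<close> is \<open>F(-n, b, c; x)\<close>.\<close>

definition hypergeom_poly :: "nat \<Rightarrow> complex \<Rightarrow> complex \<Rightarrow> complex \<Rightarrow> complex" where
  "hypergeom_poly n b c x =
     1 + (\<Sum>k=1..n. pochhammer (- of_nat n) k * pochhammer b k / pochhammer c k * (x ^ k / fact k))"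

definition G_poly :: "nat \<Rightarrow> complex \<Rightarrow> complex \<Rightarrow> complex" where
  "G_poly n \<gamma> x = hypergeom_poly n (\<gamma> - of_nat n + 1) (- \<gamma>) (- x)"

end

theory Submission
  imports Defs
begin

text \<open>
  Write \<open>a, b, c, d\<close> for \<open>x\<^sub>1\<^sub>1, x\<^sub>2\<^sub>1, x\<^sub>1\<^sub>2, x\<^sub>2\<^sub>2\<close>. Up to factorials, \<open>D\<^sup>(\<^sup>\<alpha>\<^sup>)(M)\<close> is a coefficient of the
  \<open>l\<close>-th power of the bilinear form \<open>(a z\<^sub>1 + b z\<^sub>2) (c w\<^sub>1 + d w\<^sub>2) + \<alpha> (a w\<^sub>1 + b w\<^sub>2) (c z\<^sub>1 + d z\<^sub>2)\<close>, and
  the coordinates of a highest weight vector are proportional to \<open>(-1)\<^sup>k (s choose k)\<close>. The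
  substitution \<open>z\<^sub>1 = 1 - b z, z\<^sub>2 = a z, w\<^sub>1 = 1 - b w, w\<^sub>2 = a w\<close> reduces the form to
  \<open>a c (1 + \<alpha>) + a (a d - b c) (w + \<alpha> z)\<close>, whose powers are explicit, while by the vanishing of
  alternating binomial sums it multiplies the alternating sum belonging to a highest weight vector
  only by \<open>a\<^sup>s\<close>. Cancelling \<open>a\<^sup>s\<close>, the image under \<open>\<Phi>\<^sup>(\<^sup>\<alpha>\<^sup>)\<close> is a scalar multiple of
  \<open>(a c)\<^bsup>l - s\<^esup> (a d - b c)\<^sup>s\<close>, and the scalar, which is \<open>1\<close> for \<open>\<alpha> = 0\<close>, is the claimed one.
\<close>

subsection \<open>Powers of bilinear forms\<close>

text \<open>The distributive law with one list per choice of a term from each of the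
  \<open>l\<close> factors. It matches the sum over tuples \<open>(M_1, ..., M_l)\<close> in the
  definition of the \<alpha>-determinants.\<close>

lemma sum_power_lists:
  fixes g :: "'b \<Rightarrow> 'a::comm_semiring_1"
  assumes "finite C"
  shows "(\<Sum>x\<in>C. g x) ^ l = (\<Sum>xs | length xs = l \<and> set xs \<subseteq> C. prod_list (map g xs))"
proof (induction l)
  case 0
  have "{xs :: 'b list. length xs = 0 \<and> set xs \<subseteq> C} = {[]}" by auto
  then show ?case by simp
next
  case (Suc l)
  let ?L = "{xs. length xs = l \<and> set xs \<subseteq> C}"
  have eq: "{xs. length xs = Suc l \<and> set xs \<subseteq> C} = (\<lambda>(x, xs). x # xs) ` (C \<times> ?L)"
    by (auto simp: length_Suc_conv image_iff)
  have "(\<Sum>xs | length xs = Suc l \<and> set xs \<subseteq> C. prod_list (map g xs))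
      = (\<Sum>(x, xs)\<in>C \<times> ?L. g x * prod_list (map g xs))"
    unfolding eq by (subst sum.reindex) (auto simp: inj_on_def intro!: sum.cong)
  also have "\<dots> = (\<Sum>x\<in>C. g x) * (\<Sum>xs\<in>?L. prod_list (map g xs))"
    by (simp add: sum_product sum.cartesian_product)
  finally show ?case using Suc by simp
qed

text \<open>For \<open>i > n\<close> the index lies beyond the degree and the binomial coefficient
  is 0, so the formula rewrites without a side condition.\<close>

lemma coeff_linear_power_choose:
  fixes a b :: "'a::comm_ring_1"
  shows "coeff ([:a, b:] ^ n) i = of_nat (n choose i) * b ^ i * a ^ (n - i)"
proof (cases "i \<le> n")
  case False
  have "degree ([:a, b:] ^ n) \<le> degree [:a, b:] * n" by (rule degree_power_le)
  also have "\<dots> \<le> n" by simp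
  finally show ?thesis using False by (simp add: coeff_eq_0 binomial_eq_0)
qed (rule coeff_linear_poly_power)

text \<open>Polynomials in two variables are nested: the inner variable is \<open>z\<close>, the
  outer one \<open>w\<close>. The factors are powers of \<open>1 + b z\<close>, \<open>a z\<close>,
  \<open>1 + d w\<close> and \<open>c w\<close>, and the coefficient of \<open>z^i w^j\<close> is
  extracted. The factors \<open>(a z)^p\<close> and \<open>(c w)^q\<close> force
  \<open>p \<le> i\<close> and \<open>q \<le> j\<close>.\<close>

lemma coeff_const_linear_power:
  fixes r a b c d :: "'a::comm_ring_1"
  shows "coeff (coeff ([:[:r:]:] * [:[:1, b:]:] ^ m * [:[:0, a:]:] ^ p * [:1, [:d:]:] ^ n * [:0, [:c:]:] ^ q) j) i
    = (if p \<le> i \<and> q \<le> j then r * a ^ p * c ^ q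
        * (of_nat (m choose (i - p)) * b ^ (i - p)) * (of_nat (n choose (j - q)) * d ^ (j - q)) else 0)"
proof -
  have pc: "[:x:] ^ k = [:x ^ k:]" for x :: "'b::comm_ring_1" and k
    by (rule poly_const_pow)
  have lin: "[:0, x:] ^ k = monom (x ^ k) k" for x :: "'b::comm_ring_1" and k
    using monom_power[of x 1 k] by (simp add: monom_altdef)
  let ?u = "[:r:] * [:1, b:] ^ m * [:0, a:] ^ p"
  have "[:[:r:]:] * [:[:1, b:]:] ^ m * [:[:0, a:]:] ^ p * [:1, [:d:]:] ^ n * [:0, [:c:]:] ^ q
     = smult ?u (monom ([:c:] ^ q) q * [:1, [:d:]:] ^ n)"
    by (simp add: pc lin mult_ac)
  then have "coeff ([:[:r:]:] * [:[:1, b:]:] ^ m * [:[:0, a:]:] ^ p * [:1, [:d:]:] ^ n * [:0, [:c:]:] ^ q) j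
     = (if q \<le> j then ?u * [:c ^ q * (of_nat (n choose (j - q)) * d ^ (j - q)):] else 0)"
    by (simp only: coeff_smult coeff_monom_mult coeff_linear_power_choose pc of_nat_poly power_one)
      (simp add: mult_ac)
  moreover have "coeff (?u * [:y:]) i = (if p \<le> i then r * a ^ p * y
        * (of_nat (m choose (i - p)) * b ^ (i - p)) else 0)" for y
  proof -
    have "?u * [:y:] = smult (r * y) (monom (a ^ p) p * [:1, b:] ^ m)"
      by (simp add: lin mult_ac)
    then show ?thesis by (simp add: coeff_monom_mult coeff_linear_power_choose mult_ac)
  qed
  ultimately show ?thesis by (simp only: if_distrib[where f = "\<lambda>x. coeff x i"] coeff_0) (simp add: mult_ac)
qed

text \<open>Both sides are the coefficient of \<open>z^k w^(s - k)\<close> after the substitution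
  \<open>z1 = 1 - b z\<close>, \<open>z2 = a z\<close>, \<open>w1 = 1 - b w\<close>,
  \<open>w2 = a w\<close>. It makes \<open>a z1 + b z2\<close> and \<open>a w1 + b w2\<close> equal
  to the constant \<open>a\<close>, so only a linear polynomial in \<open>z\<close> and
  \<open>w\<close> remains to be raised to the power \<open>l\<close>.\<close>

lemma coeff_bilinear_form_power:
  fixes a b c d e :: "'a::comm_ring_1" and S :: "nat \<Rightarrow> nat \<Rightarrow> 'a"
  assumes S: "\<And>z1 z2 w1 w2 :: 'a poly poly.
     ([:[:a * c + e * (a * c):]:] * z1 * w1 + [:[:a * d + e * (b * c):]:] * z1 * w2
      + [:[:b * c + e * (a * d):]:] * z2 * w1 + [:[:b * d + e * (b * d):]:] * z2 * w2) ^ l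
     = (\<Sum>p\<le>l. \<Sum>q\<le>l. [:[:S p q:]:] * z1 ^ (l - p) * z2 ^ p * w1 ^ (l - q) * w2 ^ q)"
    and "k \<le> s" "s \<le> l"
  shows "(\<Sum>p\<le>k. \<Sum>q\<le>s - k. S p q * a ^ (p + q) * (of_nat ((l - p) choose (k - p)) * (- b) ^ (k - p))
            * (of_nat ((l - q) choose (s - k - q)) * (- b) ^ (s - k - q)))
       = of_nat ((l choose (s - k)) * ((l - (s - k)) choose k)) * e ^ k
           * (a * (a * d - b * c)) ^ s * (a * c * (1 + e)) ^ (l - s)"
proof -
  let ?K = "a * c * (1 + e)" and ?M = "a * (a * d - b * c)"
  have pc: "[:x:] ^ k = [:x ^ k:]" for x :: "'a" and k
    by (rule poly_const_pow)
  \<comment> \<open>The nested polynomial on the left is \<open>?K + e * ?M * z + ?M * w\<close>,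
    the value of the form under the substitution.\<close>
  have "[:[:?K, e * ?M:], [:?M:]:] ^ l
     = (\<Sum>p\<le>l. \<Sum>q\<le>l. [:[:S p q:]:] * [:[:1, - b:]:] ^ (l - p) * [:[:0, a:]:] ^ p
          * [:1, [:- b:]:] ^ (l - q) * [:0, [:a:]:] ^ q)"
    by (subst S[symmetric], rule arg_cong[where f = "\<lambda>x. x ^ l"]) (simp add: algebra_simps)
  then have "coeff (coeff ([:[:?K, e * ?M:], [:?M:]:] ^ l) (s - k)) k
    = (\<Sum>p\<le>l. \<Sum>q\<le>l. (if p \<le> k \<and> q \<le> s - k then S p q * a ^ p * a ^ q
        * (of_nat ((l - p) choose (k - p)) * (- b) ^ (k - p))
        * (of_nat ((l - q) choose (s - k - q)) * (- b) ^ (s - k - q)) else 0))"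
    by (simp only: coeff_sum coeff_const_linear_power)
  also have "\<dots> = (\<Sum>p\<le>l. if p \<le> k then \<Sum>q\<le>l. if q \<le> s - k then S p q * a ^ p * a ^ q
        * (of_nat ((l - p) choose (k - p)) * (- b) ^ (k - p))
        * (of_nat ((l - q) choose (s - k - q)) * (- b) ^ (s - k - q)) else 0 else 0)"
    by (intro sum.cong refl) auto
  also have "\<dots> = (\<Sum>p\<in>{p\<in>{..l}. p \<le> k}. \<Sum>q\<in>{q\<in>{..l}. q \<le> s - k}. S p q * a ^ p * a ^ q
        * (of_nat ((l - p) choose (k - p)) * (- b) ^ (k - p))
        * (of_nat ((l - q) choose (s - k - q)) * (- b) ^ (s - k - q)))"
    by (simp only: sum.inter_filter[OF finite_atMost])
  also have "{p\<in>{..l}. p \<le> k} = {..k}" using assms by auto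
  also have "{q\<in>{..l}. q \<le> s - k} = {..s - k}" using assms by auto
  finally have "coeff (coeff ([:[:?K, e * ?M:], [:?M:]:] ^ l) (s - k)) k = (\<Sum>p\<le>k. \<Sum>q\<le>s - k. S p q * a ^ (p + q) * (of_nat ((l - p) choose (k - p)) * (- b) ^ (k - p))
            * (of_nat ((l - q) choose (s - k - q)) * (- b) ^ (s - k - q)))"
    by (simp add: power_add mult_ac)
  moreover have "coeff (coeff ([:[:?K, e * ?M:], [:?M:]:] ^ l) (s - k)) k
     = of_nat (l choose (s - k)) * ?M ^ (s - k) * (of_nat ((l - (s - k)) choose k) * (e * ?M) ^ k * ?K ^ (l - (s - k) - k))"
    by (simp add: coeff_linear_power_choose pc of_nat_poly)
  moreover have "l - (s - k) - k = l - s" "?M ^ s = ?M ^ (s - k) * ?M ^ k"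
    using assms by (auto simp flip: power_add)
  ultimately show ?thesis by (simp add: power_mult_distrib mult_ac)
qed

subsection \<open>The generating function of the \<open>\<alpha>\<close>-determinants\<close>

definition matrix_of_columns :: "(2 \<Rightarrow>\<^sub>0 nat) \<Rightarrow> (2 \<Rightarrow>\<^sub>0 nat) \<Rightarrow> nat^2^2" where
  "matrix_of_columns a b = (\<chi> i j. Poly_Mapping.lookup (if j = 1 then a else b) i)"

text \<open>The exponent of \<open>e\<^sub>1\<^sup>m e\<^sub>2\<^sup>n\<close>.\<close>

definition expo :: "nat \<Rightarrow> nat \<Rightarrow> 2 \<Rightarrow>\<^sub>0 nat" where
  "expo m n = Poly_Mapping.single 1 m + Poly_Mapping.single 2 n"

lemma lookup_expo [simp]:
  "Poly_Mapping.lookup (expo m n) 1 = m" "Poly_Mapping.lookup (expo m n) 2 = n"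
  by (simp_all add: expo_def lookup_add lookup_single)

lemma expo_lookup: "expo (Poly_Mapping.lookup a 1) (Poly_Mapping.lookup a 2) = a"
  by (rule poly_mapping_eqI) (metis exhaust_2 lookup_expo)

lemma expo_eq_iff [simp]: "expo m n = expo m' n' \<longleftrightarrow> m = m' \<and> n = n'"
  by (metis lookup_expo)

text \<open>Once both column sums are \<open>l\<close>, the lower row \<open>(p, q)\<close>
  determines the matrix; sums over such matrices thus become double sums.\<close>

definition column_matrix :: "nat \<Rightarrow> nat \<Rightarrow> nat \<Rightarrow> nat^2^2" where
  "column_matrix l p q = matrix_of_columns (expo (l - p) p) (expo (l - q) q)"

lemma column_matrix_nth [simp]:
  "column_matrix l p q $ 1 $ 1 = l - p" "column_matrix l p q $ 2 $ 1 = p"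
  "column_matrix l p q $ 1 $ 2 = l - q" "column_matrix l p q $ 2 $ 2 = q"
  by (simp_all add: column_matrix_def matrix_of_columns_def)

lemma mat2_eq_iff: "(A :: 'a^2^2) = B \<longleftrightarrow> A$1$1 = B$1$1 \<and> A$1$2 = B$1$2 \<and> A$2$1 = B$2$1 \<and> A$2$2 = B$2$2"
  by (auto simp: vec_eq_iff forall_2)

lemma bij_betw_column_matrix:
  "bij_betw (\<lambda>(p, q). column_matrix l p q) ({..l} \<times> {..l}) (column_sum_matrices l)"
proof (rule bij_betw_byWitness[where f' = "\<lambda>M. (M$2$1, M$2$2)"])
  show "\<forall>M\<in>column_sum_matrices l. (\<lambda>(p, q). column_matrix l p q) (M$2$1, M$2$2) = M"
    by (auto simp: column_sum_matrices_def mat2_eq_iff forall_2 sum_2)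
  show "(\<lambda>(p, q). column_matrix l p q) ` ({..l} \<times> {..l}) \<subseteq> column_sum_matrices l"
    by (auto simp: column_sum_matrices_def forall_2 sum_2)
  show "(\<lambda>M. (M$2$1, M$2$2)) ` column_sum_matrices l \<subseteq> {..l} \<times> {..l}"
    by (auto simp: column_sum_matrices_def forall_2 sum_2)
qed auto

lemma finite_column_sum_matrices: "finite (column_sum_matrices l)"
  using bij_betw_finite[OF bij_betw_column_matrix] by blast

lemma sum_column_sum_matrices:
  "(\<Sum>M\<in>column_sum_matrices l. f M) = (\<Sum>p\<le>l. \<Sum>q\<le>l. f (column_matrix l p q))"
  by (subst sum.reindex_bij_betw[OF bij_betw_column_matrix, symmetric])
    (simp add: sum.cartesian_product case_prod_unfold)

text \<open>The definite description is resolved because the position of the entry 1 in column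
  \<open>j\<close> recovers \<open>k j\<close>.\<close>

lemma alpha_det_unit_eq:
  "alpha_det_unit \<alpha> (\<chi> i j. if i = k j then 1 else 0) = alpha_det \<alpha> (k 1) (k 2)"
proof -
  have "(THE k'. ((\<chi> i j. if i = k j then 1 else 0) :: nat^2^2) = (\<chi> i j. if i = k' j then 1 else 0)) = k"
    by (rule the_equality) (auto simp: vec_eq_iff fun_eq_iff split: if_splits)
  then show ?thesis unfolding alpha_det_unit_def Let_def by simp
qed

lemma alpha_det_unit_column_matrix:
  "alpha_det_unit \<alpha> (column_matrix 1 p q)
   = alpha_det \<alpha> (if p = 0 then 1 else 2) (if q = 0 then 1 else 2)" if "p \<le> 1" "q \<le> 1"
proof -
  let ?k = "\<lambda>j :: 2. if j = 1 then (if p = 0 then 1 else 2) else (if q = 0 then 1 else 2) :: 2"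
  have "column_matrix 1 p q = (\<chi> i j. if i = ?k j then 1 else 0)"
    using that by (auto simp: mat2_eq_iff le_Suc_eq)
  then show ?thesis by (simp only: alpha_det_unit_eq) simp
qed

text \<open>\<open>D\<^sup>(\<^sup>\<alpha>\<^sup>)(M)\<close> without its normalising factor.\<close>

definition alpha_sum :: "complex \<Rightarrow> nat \<Rightarrow> nat^2^2 \<Rightarrow> xpoly" where
  "alpha_sum \<alpha> l M = (\<Sum>Ms | length Ms = l \<and> set Ms \<subseteq> column_sum_matrices 1 \<and> sum_list Ms = M.
          prod_list (map (alpha_det_unit \<alpha>) Ms))"

lemma sum_list_column_sum_matrices:
  "set Ms \<subseteq> column_sum_matrices 1 \<Longrightarrow> sum_list Ms \<in> column_sum_matrices (length Ms)"
proof (induction Ms)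
  case (Cons N Ms)
  then show ?case by (auto simp: column_sum_matrices_def forall_2 sum_2)
qed (auto simp: column_sum_matrices_def)

definition mat_monom :: "'a::comm_ring_1 \<Rightarrow> 'a \<Rightarrow> 'a \<Rightarrow> 'a \<Rightarrow> nat^2^2 \<Rightarrow> 'a" where
  "mat_monom z1 z2 w1 w2 M = z1 ^ (M$1$1) * z2 ^ (M$2$1) * w1 ^ (M$1$2) * w2 ^ (M$2$2)"

text \<open>Exponents add under multiplication, so the monomial attached to a tuple of matrices
  depends only on their sum.\<close>

lemma prod_list_mat_monom:
  "prod_list (map (\<lambda>N. [:[:f N:]:] * mat_monom z1 z2 w1 w2 N) Ms)
   = [:[:prod_list (map f Ms) :]:] * mat_monom z1 z2 w1 w2 (sum_list Ms)"
  by (induction Ms) (auto simp: mat_monom_def power_add one_pCons mult_ac)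

text \<open>The form is a sum over the four matrices with column sums 1. Its power is a sum over
  lists of such matrices, and grouping the lists by their sum \<open>M\<close> collects exactly
  \<open>alpha_sum \<alpha> l M\<close> in front of the monomial of \<open>M\<close>. The arguments
  \<open>z1\<close>, \<open>z2\<close>, \<open>w1\<close>, \<open>w2\<close> stay arbitrary so that
  they can be specialised later.\<close>

lemma alpha_sum_generating:
  fixes z1 z2 w1 w2 :: "xpoly poly poly"
  shows "([:[:alpha_det \<alpha> 1 1:]:] * z1 * w1 + [:[:alpha_det \<alpha> 1 2:]:] * z1 * w2
      + [:[:alpha_det \<alpha> 2 1:]:] * z2 * w1 + [:[:alpha_det \<alpha> 2 2:]:] * z2 * w2) ^ l
     = (\<Sum>p\<le>l. \<Sum>q\<le>l. [:[:alpha_sum \<alpha> l (column_matrix l p q):]:] * z1 ^ (l - p) * z2 ^ p * w1 ^ (l - q) * w2 ^ q)"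
    (is "?P ^ l = _")
proof -
  let ?C = "column_sum_matrices 1" and ?m = "mat_monom z1 z2 w1 w2"
  let ?L = "{Ms. length Ms = l \<and> set Ms \<subseteq> ?C}"
  let ?g = "\<lambda>N. [:[:alpha_det_unit \<alpha> N:]:] * ?m N"
  have fin: "finite ?L"
    using finite_lists_length_eq[OF finite_column_sum_matrices, of 1 l] by (simp add: conj_commute)
  have emb: "[:[:sum f A:]:] = (\<Sum>x\<in>A. [:[:f x:]:])" for f :: "(nat^2^2) list \<Rightarrow> xpoly" and A
  proof (induction A rule: infinite_finite_induct)
    case (insert x F)
    show ?case by (simp add: insert.hyps insert.IH[symmetric])
  qed auto
  have "(\<Sum>N\<in>?C. ?g N) = ?P"
    unfolding sum_column_sum_matrices
    by (simp add: alpha_det_unit_column_matrix[simplified] mat_monom_def atMost_Suc add_ac mult_ac)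
  then have "?P ^ l = (\<Sum>Ms\<in>?L. prod_list (map ?g Ms))"
    by (simp only: sum_power_lists[OF finite_column_sum_matrices, symmetric])
  also have "\<dots> = (\<Sum>Ms\<in>?L. [:[:prod_list (map (alpha_det_unit \<alpha>) Ms):]:] * ?m (sum_list Ms))"
    by (simp only: prod_list_mat_monom)
  also have "\<dots> = (\<Sum>M\<in>column_sum_matrices l. \<Sum>Ms | Ms \<in> ?L \<and> sum_list Ms = M.
      [:[:prod_list (map (alpha_det_unit \<alpha>) Ms):]:] * ?m (sum_list Ms))"
    by (rule sum.group[symmetric]) (use fin finite_column_sum_matrices sum_list_column_sum_matrices in auto)
  also have "\<dots> = (\<Sum>M\<in>column_sum_matrices l. [:[:alpha_sum \<alpha> l M:]:] * ?m M)"
  proof (rule sum.cong[OF refl])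
    fix M
    have eq: "[:[:alpha_sum \<alpha> l M:]:] * ?m M
      = (\<Sum>Ms | Ms \<in> ?L \<and> sum_list Ms = M. [:[:prod_list (map (alpha_det_unit \<alpha>) Ms):]:] * ?m M)"
      by (simp only: alpha_sum_def emb sum_distrib_right mem_Collect_eq conj_assoc)
    show "(\<Sum>Ms | Ms \<in> ?L \<and> sum_list Ms = M.
        [:[:prod_list (map (alpha_det_unit \<alpha>) Ms):]:] * ?m (sum_list Ms))
      = [:[:alpha_sum \<alpha> l M:]:] * ?m M"
      unfolding eq by (rule sum.cong[OF refl]) simp
  qed
  finally show ?thesis by (simp add: sum_column_sum_matrices mat_monom_def mult_ac)
qed

subsection \<open>The alternating sum\<close>

text \<open>Pairs of exponents also form a commutative monoid, so one embedding turns scaling into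
  ring multiplication for both polynomials and tensors.\<close>

definition const :: "complex \<Rightarrow> 'm::comm_monoid_add \<Rightarrow>\<^sub>0 complex" where
  "const c = Poly_Mapping.single 0 c"

lemma const_hom:
  "const (x + y) = const x + const y" "const (x * y) = const x * const y"
  "const 0 = 0" "const 1 = 1" "const (- x) = - const x"
  by (simp_all add: const_def single_add mult_single single_uminus)

lemma const_of_nat: "const (of_nat n) = of_nat n"
  by (simp add: const_def)

lemma const_sum: "const (sum f A) = (\<Sum>x\<in>A. const (f x))"
  by (induction A rule: infinite_finite_induct) (auto simp: const_hom)

lemma const_power: "const (x ^ n) = const x ^ n"
  by (induction n) (auto simp: const_hom)

lemma cscale_eq_const_mult: "cscale c f = const c * f"
  unfolding cscale_def const_def by (rule mult_map_scale_conv_mult)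

text \<open>This is the binomial expansion of \<open>(1 - 1)^n\<close>, divided by
  \<open>n!\<close>.\<close>

lemma sum_alternating_inverse_fact:
  "(\<Sum>i\<le>n. (- 1) ^ i / (fact i * fact (n - i)) :: complex) = (if n = 0 then 1 else 0)"
proof -
  have "(\<Sum>i\<le>n. (- 1) ^ i / (fact i * fact (n - i)) :: complex)
      = (\<Sum>i\<le>n. (- 1) ^ i * of_nat (n choose i)) / fact n"
    unfolding sum_divide_distrib by (rule sum.cong) (simp_all add: binomial_fact)
  also have "\<dots> = (if n = 0 then 1 else 0)"
    using choose_alternating_sum[of n, where 'a = complex] by auto
  finally show ?thesis .
qed

text \<open>Substituting \<open>k = p + i\<close> moves \<open>p\<close> and \<open>q\<close>
  outside and leaves an inner sum over \<open>i\<close> for fixed \<open>p\<close> and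
  \<open>q\<close>.\<close>

lemma sum_triangle_shift:
  fixes g :: "nat \<Rightarrow> nat \<Rightarrow> nat \<Rightarrow> 'a::comm_monoid_add"
  shows "(\<Sum>k\<le>s. \<Sum>p\<le>k. \<Sum>q\<le>s - k. g k p q)
       = (\<Sum>p\<le>s. \<Sum>q\<le>s - p. \<Sum>i\<le>s - p - q. g (p + i) p q)"
  unfolding sum.Sigma[OF finite_atMost ballI[OF finite_atMost]]
    sum.Sigma[OF finite_atMost ballI[OF finite_SigmaI[OF finite_atMost finite_atMost]]]
  by (rule sum.reindex_bij_witness
      [where i = "\<lambda>(p, q, i). (p + i, p, q)" and j = "\<lambda>(k, p, q). (p, q, k - p)"]) auto

text \<open>The factorial weights cancel against the binomials. With \<open>k = p + i\<close> and
  \<open>n = s - p - q\<close>, the dependence on \<open>i\<close> is only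
  \<open>(-1)^i / (i! (n - i)!)\<close>, whose sum vanishes unless \<open>n = 0\<close>. Only the
  terms with \<open>p + q = s\<close> survive, each carrying \<open>a^s\<close>.\<close>

lemma alternating_sum_convolution:
  fixes S :: "nat \<Rightarrow> nat \<Rightarrow> 'm::comm_monoid_add \<Rightarrow>\<^sub>0 complex"
  assumes "s \<le> l"
  shows "(\<Sum>k\<le>s. const ((- 1) ^ k * fact (l - k) * fact (l - (s - k))) *
      (\<Sum>p\<le>k. \<Sum>q\<le>s - k. S p q * a ^ (p + q) * (of_nat ((l - p) choose (k - p)) * (- b) ^ (k - p))
            * (of_nat ((l - q) choose (s - k - q)) * (- b) ^ (s - k - q))))
    = a ^ s * (\<Sum>k\<le>s. const ((- 1) ^ k * fact (l - k) * fact (l - (s - k))) * S k (s - k))"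
proof -
  let ?w = "\<lambda>k. (- 1) ^ k * fact (l - k) * fact (l - (s - k)) :: complex"
  let ?g = "\<lambda>k p q. const (?w k) * (S p q * a ^ (p + q) * (of_nat ((l - p) choose (k - p)) * (- b) ^ (k - p))
            * (of_nat ((l - q) choose (s - k - q)) * (- b) ^ (s - k - q)))"
  have "(\<Sum>k\<le>s. const (?w k) *
      (\<Sum>p\<le>k. \<Sum>q\<le>s - k. S p q * a ^ (p + q) * (of_nat ((l - p) choose (k - p)) * (- b) ^ (k - p))
            * (of_nat ((l - q) choose (s - k - q)) * (- b) ^ (s - k - q))))
    = (\<Sum>k\<le>s. \<Sum>p\<le>k. \<Sum>q\<le>s - k. ?g k p q)"
    by (simp only: sum_distrib_left)
  also have "\<dots> = (\<Sum>p\<le>s. \<Sum>q\<le>s - p. \<Sum>i\<le>s - p - q. ?g (p + i) p q)"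
    by (rule sum_triangle_shift)
  also have "\<dots> = (\<Sum>p\<le>s. \<Sum>q\<le>s - p. if q = s - p then a ^ s * (const (?w p) * S p q) else 0)"
  proof (intro sum.cong refl)
    fix p q assume pq: "p \<in> {..s}" "q \<in> {..s - p}"
    define n where "n = s - p - q"
    have s: "s = p + q + n" using pq by (simp add: n_def)
    \<comment> \<open>The part of the weight that does not depend on \<open>i\<close>: the
      numerators of the two binomials and the sign of \<open>p\<close>.\<close>
    define c :: complex where "c = (- 1) ^ p * fact (l - p) * fact (l - q)"
    have "(\<Sum>i\<le>n. ?g (p + i) p q)
        = (\<Sum>i\<le>n. const (c * ((- 1) ^ i / (fact i * fact (n - i)))) * (S p q * a ^ (p + q) * (- b) ^ n))"
    proof (intro sum.cong refl)
      fix i assume i: "i \<in> {..n}"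
      have ex: "p + i - p = i" "s - (p + i) - q = n - i" "l - (s - (p + i)) = l - q - (n - i)"
        using i s by auto
      have le: "i \<le> l - p" "n - i \<le> l - q" using i s assms by auto
      have "?w (p + i) * of_nat (l - p choose i) * of_nat (l - q choose (n - i))
        = c * ((- 1) ^ i / (fact i * fact (n - i)))"
        unfolding ex(3) c_def binomial_fact[OF le(1)] binomial_fact[OF le(2)]
        by (simp add: power_add)
      then have c: "const (c * ((- 1) ^ i / (fact i * fact (n - i))))
        = const (?w (p + i)) * of_nat (l - p choose i) * of_nat (l - q choose (n - i))"
        unfolding const_of_nat[symmetric] const_hom(2)[symmetric] by simp
      have b: "(- b) ^ n = (- b) ^ i * (- b) ^ (n - i)"
        using i by (simp flip: power_add)
      show "?g (p + i) p q
          = const (c * ((- 1) ^ i / (fact i * fact (n - i)))) * (S p q * a ^ (p + q) * (- b) ^ n)"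
        unfolding ex(1,2) b c by (simp only: mult_ac)
    qed
    also have "\<dots> = const (c * (\<Sum>i\<le>n. (- 1) ^ i / (fact i * fact (n - i)))) * (S p q * a ^ (p + q) * (- b) ^ n)"
      by (simp only: const_sum sum_distrib_left sum_distrib_right)
    also have "\<dots> = (if n = 0 then const c * S p q * a ^ (p + q) else 0)"
      by (simp add: sum_alternating_inverse_fact const_hom)
    also have "\<dots> = (if q = s - p then a ^ s * (const (?w p) * S p q) else 0)"
      using s by (auto simp: c_def mult_ac)
    finally show "(\<Sum>i\<le>s - p - q. ?g (p + i) p q) = (if q = s - p then a ^ s * (const (?w p) * S p q) else 0)"
      unfolding n_def .
  qed
  also have "\<dots> = a ^ s * (\<Sum>k\<le>s. const (?w k) * S k (s - k))"
    by (simp add: sum_distrib_left)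
  finally show ?thesis .
qed

lemma pvar_power: "pvar v ^ n = Poly_Mapping.single (Poly_Mapping.single v n) 1"
  by (induction n) (auto simp: pvar_def mult_single simp flip: single_add)

text \<open>Multiplication by a monomial shifts exponents, so each coefficient of \<open>f\<close>
  can be read off from the product.\<close>

lemma pvar_power_cancel:
  assumes "pvar v ^ n * f = pvar v ^ n * g"
  shows "f = g"
proof (rule poly_mapping_eqI)
  fix m
  let ?e = "Poly_Mapping.single v n"
  have "Poly_Mapping.lookup (pvar v ^ n * h) (?e + m) = Poly_Mapping.lookup h m" for h
  proof -
    have "Poly_Mapping.lookup (pvar v ^ n * h) (?e + m)
      = (\<Sum>k. (1 when k = ?e) * (\<Sum>q. Poly_Mapping.lookup h q when ?e + m = k + q))"
      unfolding pvar_power lookup_mult by (auto simp: lookup_single when_def intro!: Sum_any.cong)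
    also have "\<dots> = (\<Sum>k. (\<Sum>q. Poly_Mapping.lookup h q when ?e + m = k + q) when k = ?e)"
      by (intro Sum_any.cong) (auto simp: when_def)
    also have "\<dots> = (\<Sum>q. Poly_Mapping.lookup h q when m = q)"
      by simp
    finally show ?thesis by simp
  qed
  with assms show "Poly_Mapping.lookup f m = Poly_Mapping.lookup g m" by metis
qed

text \<open>Multiplied by the power \<open>s\<close> of the variable indexed \<open>(1, 1)\<close>,
  the left side becomes the sum evaluated by \<open>coeff_bilinear_form_power\<close>; this power is
  then cancelled. The weight \<open>w k\<close> is \<open>(-1)^k (s choose k)\<close> times the
  factorials of the matrix entries, divided by \<open>s!\<close>.\<close>

lemma alpha_sum_alternating:
  fixes \<alpha> :: complex and l s :: nat
  assumes "s \<le> l"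
  defines "w \<equiv> \<lambda>k. (- 1) ^ k * fact (l - k) * fact (l - (s - k)) :: complex"
  shows "(\<Sum>k\<le>s. const (w k) * alpha_sum \<alpha> l (column_matrix l k (s - k)))
    = const ((\<Sum>k\<le>s. w k * of_nat ((l choose (s - k)) * ((l - (s - k)) choose k)) * \<alpha> ^ k) * (1 + \<alpha>) ^ (l - s))
      * (pvar (1, 1) * pvar (1, 2)) ^ (l - s) * (pvar (1, 1) * pvar (2, 2) - pvar (2, 1) * pvar (1, 2)) ^ s"
    (is "?L = ?R")
proof (rule pvar_power_cancel)
  let ?a = "pvar (1, 1) :: xpoly" and ?b = "pvar (2, 1) :: xpoly"
  let ?c = "pvar (1, 2) :: xpoly" and ?d = "pvar (2, 2) :: xpoly"
  let ?S = "\<lambda>p q. alpha_sum \<alpha> l (column_matrix l p q)"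
  let ?e = "const \<alpha> :: xpoly" and ?D = "?a * ?d - ?b * ?c"
  have D: "alpha_det \<alpha> 1 1 = ?a * ?c + ?e * (?a * ?c)" "alpha_det \<alpha> 1 2 = ?a * ?d + ?e * (?b * ?c)"
    "alpha_det \<alpha> 2 1 = ?b * ?c + ?e * (?a * ?d)" "alpha_det \<alpha> 2 2 = ?b * ?d + ?e * (?b * ?d)"
    by (simp_all add: alpha_det_def cscale_eq_const_mult)
  have "?a ^ s * ?L = (\<Sum>k\<le>s. const (w k) *
      (\<Sum>p\<le>k. \<Sum>q\<le>s - k. ?S p q * ?a ^ (p + q) * (of_nat ((l - p) choose (k - p)) * (- ?b) ^ (k - p))
            * (of_nat ((l - q) choose (s - k - q)) * (- ?b) ^ (s - k - q))))"
    unfolding w_def by (rule alternating_sum_convolution[OF assms(1), symmetric])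
  also have "\<dots> = (\<Sum>k\<le>s. const (w k) * (of_nat ((l choose (s - k)) * ((l - (s - k)) choose k)) * ?e ^ k
           * (?a * ?D) ^ s * (?a * ?c * (1 + ?e)) ^ (l - s)))"
    by (intro sum.cong refl arg_cong2[where f = "(*)"] coeff_bilinear_form_power
        alpha_sum_generating[of \<alpha>, unfolded D] assms(1)) simp
  also have "\<dots> = const (\<Sum>k\<le>s. w k * of_nat ((l choose (s - k)) * ((l - (s - k)) choose k)) * \<alpha> ^ k)
       * ((?a * ?D) ^ s * (?a * ?c * (1 + ?e)) ^ (l - s))"
    unfolding const_sum sum_distrib_right
    by (intro sum.cong refl) (simp only: const_hom const_of_nat const_power mult_ac)
  also have "\<dots> = ?a ^ s * ?R"
    unfolding power_mult_distrib const_hom const_power by (simp only: mult_ac)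
  finally show "?a ^ s * ?L = ?a ^ s * ?R" .
qed

subsection \<open>Highest weight vectors\<close>

text \<open>Enlarging the support to any finite set lets vectors with different supports be compared
  over one index set.\<close>

lemma lin_ext_superset:
  assumes "finite A" "Poly_Mapping.keys f \<subseteq> A"
  shows "lin_ext \<phi> f = (\<Sum>a\<in>A. const (Poly_Mapping.lookup f a) * \<phi> a)"
  unfolding lin_ext_def cscale_eq_const_mult
  by (rule sum.mono_neutral_left) (use assms in \<open>auto simp: in_keys_iff const_hom\<close>)

lemma lin_ext_single: "lin_ext \<phi> (Poly_Mapping.single a c) = const c * \<phi> a"
  by (subst lin_ext_superset[of "{a}"]) auto

lemma lin_ext_add:
  fixes \<phi> :: "'a \<Rightarrow> 'b::comm_monoid_add \<Rightarrow>\<^sub>0 complex"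
  shows "lin_ext \<phi> (f + g) = lin_ext \<phi> f + lin_ext \<phi> g"
proof -
  let ?A = "Poly_Mapping.keys f \<union> Poly_Mapping.keys g"
  have "Poly_Mapping.keys (f + g) \<subseteq> ?A" by (rule keys_add)
  then show ?thesis
    by (simp add: lin_ext_superset[of ?A] lookup_add const_hom algebra_simps sum.distrib)
qed

lemma lin_ext_zero: "lin_ext \<phi> 0 = 0"
  by (simp add: lin_ext_def)

lemma lin_ext_sum:
  fixes \<phi> :: "'a \<Rightarrow> 'b::comm_monoid_add \<Rightarrow>\<^sub>0 complex"
  shows "lin_ext \<phi> (sum f A) = (\<Sum>x\<in>A. lin_ext \<phi> (f x))"
  by (induction A rule: infinite_finite_induct) (auto simp: lin_ext_zero lin_ext_add)

lemma const_mult_single: "const c * Poly_Mapping.single a x = Poly_Mapping.single a (c * x)"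
  by (simp add: const_def mult_single)

lemma lin_ext_const_mult:
  fixes \<phi> :: "'a::comm_monoid_add \<Rightarrow> 'b::comm_monoid_add \<Rightarrow>\<^sub>0 complex"
  shows "lin_ext \<phi> (const c * f) = const c * lin_ext \<phi> f"
proof -
  have lookup: "Poly_Mapping.lookup (const c * f) a = c * Poly_Mapping.lookup f a" for a
    unfolding cscale_eq_const_mult[symmetric] cscale_def by (simp add: map.rep_eq when_def)
  then have "Poly_Mapping.keys (const c * f) \<subseteq> Poly_Mapping.keys f"
    by (auto simp: in_keys_iff)
  then show ?thesis
    by (simp only: lin_ext_superset[OF finite_keys[of f]] order_refl lookup const_hom sum_distrib_left mult.assoc)
qed

lemma sum_single_lookup:
  assumes "finite A" "Poly_Mapping.keys f \<subseteq> A"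
  shows "f = (\<Sum>a\<in>A. Poly_Mapping.single a (Poly_Mapping.lookup f a))"
  by (rule poly_mapping_eqI)
    (use assms in \<open>auto simp: lookup_sum lookup_single when_def in_keys_iff subset_iff sum.delta\<close>)

section \<open>The matrix units on basis vectors\<close>

lemma sym_act_single:
  "sym_act i j (Poly_Mapping.single a 1)
   = Poly_Mapping.single (Poly_Mapping.single i 1 + (a - Poly_Mapping.single j 1)) (of_nat (Poly_Mapping.lookup a j))"
  by (simp add: sym_act_def partial_deriv_def lin_ext_single pvar_def const_mult_single mult_single)

lemma tensor_single:
  "tensor (Poly_Mapping.single a x) (Poly_Mapping.single b y) = Poly_Mapping.single (a, b) (x * y)"
  by (simp add: tensor_def lin_ext_single const_mult_single)

lemma tensor_act_single:
  "tensor_act i j (Poly_Mapping.single (a, b) c)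
   = Poly_Mapping.single (Poly_Mapping.single i 1 + (a - Poly_Mapping.single j 1), b) (c * of_nat (Poly_Mapping.lookup a j))
   + Poly_Mapping.single (a, Poly_Mapping.single i 1 + (b - Poly_Mapping.single j 1)) (c * of_nat (Poly_Mapping.lookup b j))"
  by (simp add: tensor_act_def lin_ext_single sym_act_single tensor_single algebra_simps const_mult_single)

lemma tensor_act_diag_single:
  "tensor_act i i (Poly_Mapping.single (a, b) c)
   = Poly_Mapping.single (a, b) (c * of_nat (Poly_Mapping.lookup a i + Poly_Mapping.lookup b i))"
proof -
  \<comment> \<open>Subtraction of exponents is truncated, so this fails for a zero exponent; there
    the coefficient of the term is 0 instead.\<close>
  have *: "Poly_Mapping.single i 1 + (m - Poly_Mapping.single i 1) = m"
    if "Poly_Mapping.lookup m i \<noteq> 0" for m :: "2 \<Rightarrow>\<^sub>0 nat"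
    using that by (intro poly_mapping_eqI) (auto simp: lookup_add lookup_minus lookup_single when_def)
  show ?thesis
    using *[of a] *[of b]
    by (cases "Poly_Mapping.lookup a i = 0"; cases "Poly_Mapping.lookup b i = 0")
      (simp_all add: tensor_act_single distrib_left flip: single_add)
qed

lemma lookup_tensor_act_diag:
  "Poly_Mapping.lookup (tensor_act i i w) (a, b)
   = Poly_Mapping.lookup w (a, b) * of_nat (Poly_Mapping.lookup a i + Poly_Mapping.lookup b i)"
proof -
  have "tensor_act i i w = (\<Sum>x\<in>Poly_Mapping.keys w. tensor_act i i (Poly_Mapping.single x (Poly_Mapping.lookup w x)))"
    by (subst sum_single_lookup[OF _ order_refl]) (simp_all add: tensor_act_def lin_ext_sum)
  also have "\<dots> = (\<Sum>x\<in>Poly_Mapping.keys w. Poly_Mapping.single x (Poly_Mapping.lookup w x *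
      of_nat (Poly_Mapping.lookup (fst x) i + Poly_Mapping.lookup (snd x) i)))"
    by (intro sum.cong refl) (auto simp: tensor_act_diag_single)
  finally show ?thesis
    by (auto simp: lookup_sum lookup_single when_def in_keys_iff sum.delta)
qed

lemma tensor_act_12_single:
  "tensor_act 1 2 (Poly_Mapping.single (expo m n, expo m' n') c)
   = Poly_Mapping.single (expo (Suc m) (n - 1), expo m' n') (c * of_nat n)
   + Poly_Mapping.single (expo m n, expo (Suc m') (n' - 1)) (c * of_nat n')"
proof -
  have "Poly_Mapping.single 1 1 + (expo i j - Poly_Mapping.single 2 1) = expo (Suc i) (j - 1)" for i j
  proof (rule poly_mapping_eqI)
    fix k :: 2
    show "Poly_Mapping.lookup (Poly_Mapping.single 1 1 + (expo i j - Poly_Mapping.single 2 1)) k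
      = Poly_Mapping.lookup (expo (Suc i) (j - 1)) k"
      using exhaust_2[of k] by (auto simp: lookup_add lookup_minus lookup_single)
  qed
  then show ?thesis by (simp add: tensor_act_single)
qed

text \<open>The label of the \<open>k\<close>-th basis vector of weight \<open>(2l - s, s)\<close>.\<close>

definition weight_vec :: "nat \<Rightarrow> nat \<Rightarrow> nat \<Rightarrow> (2 \<Rightarrow>\<^sub>0 nat) \<times> (2 \<Rightarrow>\<^sub>0 nat)" where
  "weight_vec l s k = (expo (l - k) k, expo (l - (s - k)) (s - k))"

lemma weight_vec_inj [simp]: "weight_vec l s j = weight_vec l s k \<longleftrightarrow> j = k"
  by (auto simp: weight_vec_def)

text \<open>The raising operator on the first factor of the vector with index \<open>j + 1\<close>
  and on the second factor of the vector with index \<open>j\<close> yields the same basis vector,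
  of weight \<open>(2l - s + 1, s - 1)\<close>. Hence each coefficient of the image is a two-term
  combination.\<close>

lemma tensor_act_12_sum:
  assumes "s \<le> l"
  shows "tensor_act 1 2 (\<Sum>k\<le>s. Poly_Mapping.single (weight_vec l s k) (c k))
    = (\<Sum>j<s. Poly_Mapping.single (weight_vec l (s - 1) j) (c (Suc j) * of_nat (Suc j) + c j * of_nat (s - j)))"
proof -
  let ?f = "\<lambda>k. Poly_Mapping.single (expo (Suc (l - k)) (k - 1), expo (l - (s - k)) (s - k)) (c k * of_nat k)"
  let ?g = "\<lambda>k. Poly_Mapping.single (expo (l - k) k, expo (Suc (l - (s - k))) (s - k - 1)) (c k * of_nat (s - k))"
  have "tensor_act 1 2 (\<Sum>k\<le>s. Poly_Mapping.single (weight_vec l s k) (c k))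
      = (\<Sum>k\<le>s. tensor_act 1 2 (Poly_Mapping.single (weight_vec l s k) (c k)))"
    by (simp add: tensor_act_def lin_ext_sum)
  also have "\<dots> = (\<Sum>k\<le>s. ?f k) + (\<Sum>k\<le>s. ?g k)"
    by (simp add: weight_vec_def tensor_act_12_single sum.distrib)
  \<comment> \<open>The term \<open>k = 0\<close> vanishes by its factor \<open>k\<close>; the shift
    aligns the indices with those of \<open>?g\<close>, whose last term vanishes by its factor
    \<open>s - k\<close>.\<close>
  also have "(\<Sum>k\<le>s. ?f k) = (\<Sum>k<s. ?f (Suc k))"
    by (simp add: sum.atMost_shift)
  also have "\<dots> = (\<Sum>j<s. Poly_Mapping.single (weight_vec l (s - 1) j) (c (Suc j) * of_nat (Suc j)))"
    using assms by (intro sum.cong refl) (simp add: weight_vec_def Suc_diff_Suc diff_diff_left)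
  also have "(\<Sum>k\<le>s. ?g k) = (\<Sum>k<s. ?g k)"
    by (simp flip: lessThan_Suc_atMost)
  also have "\<dots> = (\<Sum>j<s. Poly_Mapping.single (weight_vec l (s - 1) j) (c j * of_nat (s - j)))"
  proof (intro sum.cong refl)
    fix j assume "j \<in> {..<s}"
    then have "Suc (l - (s - j)) = l - (s - 1 - j)" "s - j - 1 = s - 1 - j" using assms by auto
    then show "?g j = Poly_Mapping.single (weight_vec l (s - 1) j) (c j * of_nat (s - j))"
      unfolding weight_vec_def by (simp only:)
  qed
  finally show ?thesis by (simp add: single_add sum.distrib)
qed

text \<open>The coefficients solve the recurrence \<open>(j + 1) c(j + 1) + (s - j) c(j) = 0\<close>
  with \<open>c(0) = 1\<close>, which expresses annihilation by \<open>E_12\<close>.\<close>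

definition highest_weight_vec :: "nat \<Rightarrow> nat \<Rightarrow> sym_tensor" where
  "highest_weight_vec l s = (\<Sum>k\<le>s. Poly_Mapping.single (weight_vec l s k) ((- 1) ^ k * of_nat (s choose k)))"

lemma binomial_shift: "Suc j * (s choose Suc j) = (s - j) * (s choose j)"
  by (simp only: binomial_absorption binomial_absorb_comp)

text \<open>The degree condition and the \<open>E_22\<close>-eigenvalue confine the support to the
  vectors \<open>weight_vec l s k\<close>; annihilation by \<open>E_12\<close> then gives a
  recurrence that determines all coefficients from the one with index 0.\<close>

lemma highest_weight_space_coeffs:
  assumes v: "v \<in> highest_weight_space l (2 * l - s, s)" and "s \<le> l"
  shows "v = const (Poly_Mapping.lookup v (weight_vec l s 0)) * highest_weight_vec l s"
proof -
  let ?c = "\<lambda>k. Poly_Mapping.lookup v (weight_vec l s k)"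
  have 22: "tensor_act 2 2 v = cscale (of_nat s) v" and 12: "tensor_act 1 2 v = 0"
    and l: "\<And>a b. (a, b) \<in> Poly_Mapping.keys v \<Longrightarrow>
      Poly_Mapping.lookup a 1 + Poly_Mapping.lookup a 2 = l \<and> Poly_Mapping.lookup b 1 + Poly_Mapping.lookup b 2 = l"
    using v by (auto simp: highest_weight_space_def sym_power_tensor_def sum_2)
  have keys: "Poly_Mapping.keys v \<subseteq> weight_vec l s ` {..s}"
  proof clarify
    fix a b assume ab: "(a, b) \<in> Poly_Mapping.keys v"
    have "Poly_Mapping.lookup v (a, b) * of_nat (Poly_Mapping.lookup a 2 + Poly_Mapping.lookup b 2)
      = of_nat s * Poly_Mapping.lookup v (a, b)"
      using arg_cong[OF 22, of "\<lambda>w. Poly_Mapping.lookup w (a, b)"]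
      by (simp add: lookup_tensor_act_diag cscale_def map.rep_eq when_def)
    then have "(of_nat (Poly_Mapping.lookup a 2 + Poly_Mapping.lookup b 2) :: complex) = of_nat s"
      using ab by (simp add: in_keys_iff mult.commute)
    then have s: "Poly_Mapping.lookup a 2 + Poly_Mapping.lookup b 2 = s"
      by (simp only: of_nat_eq_iff)
    have "(a, b) = weight_vec l s (Poly_Mapping.lookup a 2)"
    proof -
      have "l - Poly_Mapping.lookup a 2 = Poly_Mapping.lookup a 1"
        "s - Poly_Mapping.lookup a 2 = Poly_Mapping.lookup b 2"
        "l - Poly_Mapping.lookup b 2 = Poly_Mapping.lookup b 1"
        using l[OF ab] s by auto
      then show ?thesis by (simp add: weight_vec_def expo_lookup)
    qed
    then show "(a, b) \<in> weight_vec l s ` {..s}" using s by auto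
  qed
  have v_eq: "v = (\<Sum>k\<le>s. Poly_Mapping.single (weight_vec l s k) (?c k))"
    by (subst sum_single_lookup[OF _ keys]) (auto simp: sum.reindex inj_on_def)
  \<comment> \<open>The vectors \<open>weight_vec l (s - 1) j\<close> are distinct for distinct
    \<open>j\<close>, so every coefficient of the image must vanish separately.\<close>
  have rec: "?c (Suc j) * of_nat (Suc j) + ?c j * of_nat (s - j) = 0" if "j < s" for j
  proof -
    have "(\<Sum>j<s. Poly_Mapping.single (weight_vec l (s - 1) j) (?c (Suc j) * of_nat (Suc j) + ?c j * of_nat (s - j))) = 0"
      using 12 by (subst (asm) v_eq) (simp only: tensor_act_12_sum[OF \<open>s \<le> l\<close>])
    from arg_cong[OF this, of "\<lambda>w. Poly_Mapping.lookup w (weight_vec l (s - 1) j)"]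
    show ?thesis using that
      by (simp add: lookup_sum lookup_single when_def del: of_nat_Suc)
  qed
  have c: "?c k = ?c 0 * ((- 1) ^ k * of_nat (s choose k))" if "k \<le> s" for k
    using that
  proof (induction k)
    case (Suc k)
    have "?c (Suc k) * of_nat (Suc k) = - (?c k * of_nat (s - k))"
      using rec[of k] Suc.prems by (simp only: eq_neg_iff_add_eq_0)
    also have "?c k = ?c 0 * ((- 1) ^ k * of_nat (s choose k))" using Suc by simp
    also have "- (\<dots> * of_nat (s - k)) = - (?c 0 * (- 1) ^ k) * of_nat ((s - k) * (s choose k))"
      by (simp only: of_nat_mult mult_ac mult_minus_left mult_minus_right)
    also have "\<dots> = ?c 0 * ((- 1) ^ Suc k * of_nat (s choose Suc k)) * of_nat (Suc k)"
      by (simp only: binomial_shift[symmetric] of_nat_mult) (simp del: of_nat_Suc)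
    finally have "?c (Suc k) * of_nat (Suc k)
        = ?c 0 * ((- 1) ^ Suc k * of_nat (s choose Suc k)) * of_nat (Suc k)" .
    then show ?case unfolding mult_right_cancel[OF of_nat_neq_0] .
  qed simp
  note v_eq
  also have "(\<Sum>k\<le>s. Poly_Mapping.single (weight_vec l s k) (?c k)) = const (?c 0) * highest_weight_vec l s"
    unfolding highest_weight_vec_def sum_distrib_left const_mult_single
    by (intro sum.cong refl arg_cong[where f = "Poly_Mapping.single _"] c) simp
  finally show ?thesis .
qed

lemma highest_weight_vec_in_space:
  assumes "s \<le> l"
  shows "highest_weight_vec l s \<in> highest_weight_space l (2 * l - s, s)"
proof -
  have keys: "Poly_Mapping.keys (highest_weight_vec l s) \<subseteq> weight_vec l s ` {..s}"
  proof
    fix x assume "x \<in> Poly_Mapping.keys (highest_weight_vec l s)"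
    then have "(\<Sum>k\<le>s. Poly_Mapping.lookup (Poly_Mapping.single (weight_vec l s k) ((- 1) ^ k * of_nat (s choose k))) x)
        \<noteq> (0 :: complex)"
      by (simp add: in_keys_iff highest_weight_vec_def lookup_sum)
    then obtain k where "k \<le> s"
      "Poly_Mapping.lookup (Poly_Mapping.single (weight_vec l s k) ((- 1) ^ k * of_nat (s choose k))) x \<noteq> (0 :: complex)"
      by (rule sum.not_neutral_contains_not_neutral) auto
    then show "x \<in> weight_vec l s ` {..s}"
      by (auto simp: lookup_single when_def split: if_splits)
  qed
  have keysE: "\<exists>k\<le>s. a = expo (l - k) k \<and> b = expo (l - (s - k)) (s - k)"
    if "(a, b) \<in> Poly_Mapping.keys (highest_weight_vec l s)" for a b
    using subsetD[OF keys that] by (auto simp: weight_vec_def)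
  \<comment> \<open>\<open>E_ii\<close> multiplies each basis vector by the total exponent of
    \<open>e_i\<close>, so a constant total on the support gives an eigenvector.\<close>
  have diag: "tensor_act i i w = cscale (of_nat n) w"
    if "\<And>a b. (a, b) \<in> Poly_Mapping.keys w \<Longrightarrow> Poly_Mapping.lookup a i + Poly_Mapping.lookup b i = n" for i n w
  proof (rule poly_mapping_eqI)
    fix x :: "(2 \<Rightarrow>\<^sub>0 nat) \<times> (2 \<Rightarrow>\<^sub>0 nat)"
    obtain a b where x: "x = (a, b)" by (cases x)
    show "Poly_Mapping.lookup (tensor_act i i w) x = Poly_Mapping.lookup (cscale (of_nat n) w) x"
      using that[of a b] unfolding x lookup_tensor_act_diag
      by (cases "(a, b) \<in> Poly_Mapping.keys w") (auto simp: cscale_def map.rep_eq when_def in_keys_iff)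
  qed
  have "tensor_act 1 2 (highest_weight_vec l s) = 0"
    unfolding highest_weight_vec_def tensor_act_12_sum[OF assms]
  proof (intro sum.neutral ballI)
    fix j
    have "(- 1) ^ Suc j * of_nat (s choose Suc j) * of_nat (Suc j) = - ((- 1) ^ j * (of_nat (Suc j * (s choose Suc j)) :: complex))"
      by (simp only: of_nat_mult power_Suc) simp
    also have "\<dots> = - ((- 1) ^ j * of_nat (s choose j) * of_nat (s - j))"
      unfolding binomial_shift by simp
    finally have *: "(- 1) ^ Suc j * of_nat (s choose Suc j) * of_nat (Suc j)
      = - ((- 1) ^ j * of_nat (s choose j) * of_nat (s - j) :: complex)" .
    show "Poly_Mapping.single (weight_vec l (s - 1) j) ((- 1) ^ Suc j * of_nat (s choose Suc j) * of_nat (Suc j)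
        + (- 1) ^ j * of_nat (s choose j) * of_nat (s - j)) = (0 :: sym_tensor)"
      by (simp only: * left_minus single_zero)
  qed
  moreover have "highest_weight_vec l s \<in> sym_power_tensor l"
    using assms by (auto simp: sym_power_tensor_def sum_2 dest!: keysE)
  moreover have "tensor_act 1 1 (highest_weight_vec l s) = cscale (of_nat (2 * l - s)) (highest_weight_vec l s)"
    by (rule diag) (use assms in \<open>auto dest!: keysE\<close>)
  moreover have "tensor_act 2 2 (highest_weight_vec l s) = cscale (of_nat s) (highest_weight_vec l s)"
    by (rule diag) (use assms in \<open>auto dest!: keysE\<close>)
  ultimately show ?thesis by (simp add: highest_weight_space_def)
qed

subsection \<open>The transition scalar\<close>

lemma alpha_det_matrix_column_matrix:
  "alpha_det_matrix \<alpha> l (column_matrix l p q)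
   = const (fact (l - p) * fact p * fact (l - q) * fact q / (fact l)\<^sup>2) * alpha_sum \<alpha> l (column_matrix l p q)"
  unfolding alpha_det_matrix_def alpha_sum_def cscale_eq_const_mult
  by (simp add: UNIV_2 mult_ac)

lemma Phi_single: "Phi \<alpha> l (Poly_Mapping.single (a, b) c) = const c * alpha_det_matrix \<alpha> l (matrix_of_columns a b)"
  by (simp add: Phi_def lin_ext_single matrix_of_columns_def)

lemma Phi_sum: "Phi \<alpha> l (sum f A) = (\<Sum>x\<in>A. Phi \<alpha> l (f x))"
  unfolding Phi_def by (rule lin_ext_sum)

section \<open>The hypergeometric polynomial in terms of factorials\<close>

lemma pochhammer_of_nat_plus_1:
  "pochhammer (of_nat n + 1) k = (fact (n + k) / fact n :: complex)"
  using pochhammer_product'[of "1 :: complex" n k] by (simp add: add.commute flip: pochhammer_fact)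

lemma pochhammer_neg_of_nat:
  "k \<le> n \<Longrightarrow> pochhammer (- of_nat n) k = ((- 1) ^ k * fact n / fact (n - k) :: complex)"
proof (induction k)
  case (Suc k)
  then have "n - k = Suc (n - Suc k)" by simp
  then have "(fact (n - k) :: complex) = (of_nat n - of_nat k) * fact (n - Suc k)"
    using Suc.prems by (metis Suc_leD fact_Suc of_nat_diff)
  then show ?case using Suc by (simp add: pochhammer_Suc divide_simps) (simp add: algebra_simps)
qed simp

text \<open>The leading 1 is the term \<open>k = 0\<close>. Since \<open>k \<le> s \<le> l\<close>,
  the denominators \<open>pochhammer (- of_nat l) k\<close> are nonzero and all Pochhammer symbols
  become quotients of factorials; of the signs, a single \<open>(-1)^k\<close> remains.\<close>

lemma G_poly_eq_sum:
  assumes "s \<le> l"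
  shows "G_poly s (of_nat l) \<alpha> = fact s / (fact l)\<^sup>2 * (\<Sum>k\<le>s. (- 1) ^ k * fact (l - k) * fact (l - (s - k))
       * of_nat ((l choose (s - k)) * ((l - (s - k)) choose k)) * \<alpha> ^ k)"
proof -
  let ?t = "\<lambda>k. pochhammer (- of_nat s) k * pochhammer (of_nat l - of_nat s + 1) k / pochhammer (- of_nat l) k
      * ((- \<alpha>) ^ k / fact k) :: complex"
  have "G_poly s (of_nat l) \<alpha> = (\<Sum>k\<le>s. ?t k)"
    by (simp add: G_poly_def hypergeom_poly_def sum.atMost_shift sum.atLeast1_atMost_eq)
  also have "\<dots> = (\<Sum>k\<le>s. fact s / (fact l)\<^sup>2 * ((- 1) ^ k * fact (l - k) * fact (l - (s - k))
       * of_nat ((l choose (s - k)) * ((l - (s - k)) choose k)) * \<alpha> ^ k))"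
  proof (intro sum.cong refl)
    fix k assume "k \<in> {..s}"
    then have k: "k \<le> s" "k \<le> l" "s - k \<le> l" "k \<le> l - (s - k)" and ex: "l - s + k = l - (s - k)" "l - (s - k) - k = l - s"
      using assms by auto
    have p: "pochhammer (of_nat l - of_nat s + 1) k = (fact (l - (s - k)) / fact (l - s) :: complex)"
      using pochhammer_of_nat_plus_1[of "l - s" k] unfolding ex(1) of_nat_diff[OF assms] .
    have m: "(- \<alpha>) ^ k = (- 1) ^ k * \<alpha> ^ k" by (rule power_minus)
    \<comment> \<open>Here \<open>u\<close> is the sign, \<open>S\<close>, \<open>S'\<close>,
      \<open>L\<close>, \<open>L'\<close>, \<open>K\<close> are the factorials of \<open>s\<close>,
      \<open>s - k\<close>, \<open>l\<close>, \<open>l - k\<close>, \<open>k\<close>, while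
      \<open>A\<close> and \<open>B\<close> are those of \<open>l - (s - k)\<close> and
      \<open>l - s\<close>, and \<open>x\<close> is \<open>\<alpha> ^ k\<close>.\<close>
    have alg: "u * S / S' * (A / B) / (u * L / L') * (u * x / K)
        = S / L\<^sup>2 * (u * L' * A * (L / (S' * A) * (A / (K * B))) * x)"
      if "u \<noteq> 0" "A \<noteq> 0" "L \<noteq> 0" for u S S' A B L L' x K :: complex
      using that by (simp add: power2_eq_square mult_ac)
    show "?t k = fact s / (fact l)\<^sup>2 * ((- 1) ^ k * fact (l - k) * fact (l - (s - k))
       * of_nat ((l choose (s - k)) * ((l - (s - k)) choose k)) * \<alpha> ^ k)"
      unfolding p pochhammer_neg_of_nat[OF k(1)] pochhammer_neg_of_nat[OF k(2)] of_nat_mult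
        binomial_fact[OF k(3)] binomial_fact[OF k(4)] ex m
      by (rule alg) simp_all
  qed
  finally show ?thesis by (simp only: sum_distrib_left)
qed

lemma Phi_highest_weight_vec:
  assumes "s \<le> l"
  shows "Phi \<alpha> l (highest_weight_vec l s)
    = const ((1 + \<alpha>) ^ (l - s) * G_poly s (of_nat l) \<alpha>)
      * ((pvar (1, 1) * pvar (1, 2)) ^ (l - s) * (pvar (1, 1) * pvar (2, 2) - pvar (2, 1) * pvar (1, 2)) ^ s)"
proof -
  let ?w = "\<lambda>k. (- 1) ^ k * fact (l - k) * fact (l - (s - k)) :: complex"
  have "Phi \<alpha> l (highest_weight_vec l s) = (\<Sum>k\<le>s. const ((- 1) ^ k * of_nat (s choose k))
      * alpha_det_matrix \<alpha> l (column_matrix l k (s - k)))"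
    unfolding highest_weight_vec_def
    by (simp add: Phi_sum weight_vec_def column_matrix_def Phi_single)
  also have "\<dots> = (\<Sum>k\<le>s. const (fact s / (fact l)\<^sup>2) * (const (?w k) * alpha_sum \<alpha> l (column_matrix l k (s - k))))"
  proof (intro sum.cong refl)
    fix k assume "k \<in> {..s}"
    \<comment> \<open>The factorials of the lower row \<open>(k, s - k)\<close> cancel the
      denominator of the binomial, leaving the weights of the alternating sum.\<close>
    then have eq: "(- 1) ^ k * of_nat (s choose k) * (fact (l - k) * fact k * fact (l - (s - k)) * fact (s - k) / (fact l)\<^sup>2)
        = fact s / (fact l)\<^sup>2 * ?w k"
      by (simp add: binomial_fact)
    have assoc: "const x * (const y * p) = const (x * y) * p" for x y and p :: xpoly
      by (simp only: const_hom(2) mult.assoc)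
    show "const ((- 1) ^ k * of_nat (s choose k)) * alpha_det_matrix \<alpha> l (column_matrix l k (s - k))
        = const (fact s / (fact l)\<^sup>2) * (const (?w k) * alpha_sum \<alpha> l (column_matrix l k (s - k)))"
      unfolding alpha_det_matrix_column_matrix assoc eq ..
  qed
  also have "\<dots> = const (fact s / (fact l)\<^sup>2) * (\<Sum>k\<le>s. const (?w k) * alpha_sum \<alpha> l (column_matrix l k (s - k)))"
    by (simp only: sum_distrib_left)
  also have "\<dots> = const (fact s / (fact l)\<^sup>2 *
      (\<Sum>k\<le>s. ?w k * of_nat ((l choose (s - k)) * ((l - (s - k)) choose k)) * \<alpha> ^ k) * (1 + \<alpha>) ^ (l - s))
      * ((pvar (1, 1) * pvar (1, 2)) ^ (l - s) * (pvar (1, 1) * pvar (2, 2) - pvar (2, 1) * pvar (1, 2)) ^ s)"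
    unfolding alpha_sum_alternating[OF assms] unfolding const_hom(2) by (simp only: mult_ac)
  finally show ?thesis unfolding G_poly_eq_sum[OF assms, symmetric] by (simp only: mult.commute)
qed

text \<open>In the binomial expansion the exponent of the variable \<open>(2, 1)\<close> is
  \<open>k\<close>, so the monomial with \<open>k = 0\<close> occurs once, with coefficient
  1.\<close>

lemma highest_weight_poly_nonzero:
  "(pvar (1, 1) * pvar (1, 2)) ^ m * (pvar (1, 1) * pvar (2, 2) - pvar (2, 1) * pvar (1, 2)) ^ s \<noteq> (0 :: xpoly)"
    (is "?p ^ m * (?u - ?v) ^ s \<noteq> 0")
proof
  let ?e = "\<lambda>k. Poly_Mapping.single (1, 1) m + Poly_Mapping.single (1, 2) m
     + (Poly_Mapping.single (2, 1) k + Poly_Mapping.single (1, 2) k)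
     + (Poly_Mapping.single (1, 1) (s - k) + Poly_Mapping.single (2, 2) (s - k)) :: 2 \<times> 2 \<Rightarrow>\<^sub>0 nat"
  have "?p ^ m * (?u - ?v) ^ s = (\<Sum>k\<le>s. Poly_Mapping.single (?e k) (of_nat (s choose k) * (- 1) ^ k))"
  proof -
    have pm: "(- ?v) ^ k = (- 1) ^ k * ?v ^ k" for k by (rule power_minus)
    have "?p ^ m * (- ?v + ?u) ^ s = (\<Sum>k\<le>s. ?p ^ m * (of_nat (s choose k) * (- ?v) ^ k * ?u ^ (s - k)))"
      by (simp only: binomial_ring sum_distrib_left)
    also have "\<dots> = (\<Sum>k\<le>s. const (of_nat (s choose k) * (- 1) ^ k) * (?p ^ m * ?v ^ k * ?u ^ (s - k)))"
      by (intro sum.cong refl) (simp only: pm const_hom const_of_nat const_power, simp only: mult_ac)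
    also have "\<dots> = (\<Sum>k\<le>s. Poly_Mapping.single (?e k) (of_nat (s choose k) * (- 1) ^ k))"
      by (simp add: power_mult_distrib pvar_power mult_single const_mult_single)
    finally show ?thesis by simp
  qed
  moreover have "?e k = ?e 0 \<longleftrightarrow> k = 0" for k
  proof
    assume "?e k = ?e 0"
    then have "Poly_Mapping.lookup (?e k) (2, 1) = Poly_Mapping.lookup (?e 0) (2, 1)" by (rule arg_cong)
    then show "k = 0" by (simp add: lookup_add lookup_single)
  qed simp
  ultimately have "Poly_Mapping.lookup (?p ^ m * (?u - ?v) ^ s) (?e 0) = 1"
    by (simp only: lookup_sum lookup_single when_def) simp
  moreover assume "?p ^ m * (?u - ?v) ^ s = 0"
  ultimately show False by simp
qed

theorem theorem4p1:
  fixes l s :: nat and \<alpha> :: complex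
  assumes "s \<le> l"
  shows "transition_scalar l (2 * l - s, s) \<alpha> = (1 + \<alpha>) ^ (l - s) * G_poly s (of_nat l) \<alpha>"
proof -
  let ?F = "\<lambda>\<alpha>. (1 + \<alpha>) ^ (l - s) * G_poly s (of_nat l) \<alpha>"
  let ?w = "highest_weight_vec l s"
  define h :: xpoly where "h = (pvar (1, 1) * pvar (1, 2)) ^ (l - s)
      * (pvar (1, 1) * pvar (2, 2) - pvar (2, 1) * pvar (1, 2)) ^ s"
  have h: "h \<noteq> 0" unfolding h_def by (rule highest_weight_poly_nonzero)
  have Phi: "Phi \<beta> l ?w = const (?F \<beta>) * h" for \<beta>
    unfolding h_def by (rule Phi_highest_weight_vec[OF assms])
  \<comment> \<open>At \<open>\<alpha> = 0\<close> every hypergeometric term with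
    \<open>k \<ge> 1\<close> contains a positive power of 0.\<close>
  have "?F 0 = 1"
    by (auto simp: G_poly_def hypergeom_poly_def intro!: sum.neutral)
  then have Phi0: "Phi 0 l ?w = h" using Phi[of 0] by (simp add: const_hom)
  have Phi_scale: "Phi \<beta> l (const c * v) = const c * Phi \<beta> l v" for \<beta> c v
    unfolding Phi_def by (rule lin_ext_const_mult)
  show ?thesis
    unfolding transition_scalar_def
  proof (rule the_equality)
    show "\<forall>v\<in>highest_weight_space l (2 * l - s, s). v \<noteq> 0 \<longrightarrow> Phi \<alpha> l v = cscale (?F \<alpha>) (Phi 0 l v)"
    proof (intro ballI impI)
      fix v assume "v \<in> highest_weight_space l (2 * l - s, s)"
      then obtain c where v: "v = const c * ?w"
        using highest_weight_space_coeffs[OF _ assms] by blast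
      show "Phi \<alpha> l v = cscale (?F \<alpha>) (Phi 0 l v)"
        unfolding v Phi_scale Phi0 Phi[of \<alpha>] cscale_eq_const_mult by (simp only: mult_ac)
    qed
  next
    fix c assume c: "\<forall>v\<in>highest_weight_space l (2 * l - s, s). v \<noteq> 0 \<longrightarrow> Phi \<alpha> l v = cscale c (Phi 0 l v)"
    \<comment> \<open>For uniqueness, the condition is tested on \<open>?w\<close>, which is nonzero
      because its image \<open>h\<close> is; a nonzero coefficient of \<open>h\<close> then
      determines the scalar.\<close>
    have "?w \<noteq> 0" using Phi0 h by (auto simp: Phi_def lin_ext_zero)
    with c highest_weight_vec_in_space[OF assms] have "Phi \<alpha> l ?w = cscale c (Phi 0 l ?w)" by blast
    then have "cscale (?F \<alpha>) h = cscale c h" by (simp only: Phi[of \<alpha>] Phi0 cscale_eq_const_mult)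
    moreover obtain m where "Poly_Mapping.lookup h m \<noteq> 0" using h by (metis poly_mapping_eqI lookup_zero)
    ultimately show "c = ?F \<alpha>"
      by (auto simp: cscale_def map.rep_eq when_def dest!: arg_cong[where f = "\<lambda>p. Poly_Mapping.lookup p m"])
  qed
qed

end
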